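(* Let $X$ be a metric space, let $f:\mathbb{R}\to X$ be a stable continuous map, and let $M=\overline{f(\mathbb{R})}$ be the closure of its image in $X$. For $\alpha\in\mathcal{E}_f$ let $f_\alpha:M\to S^1$ be the map given by $f_\alpha\left(\lim_i f(t_i)\right)=\lim_i \pi(\alpha t_i)$ for every sequence $\{t_i\}$ of reals for which $\{f(t_i)\}$ converges in $X$, and let $[f_\alpha]$ denote its homotopy class. Then the map $\iota:\mathcal{E}_f\to[M;S^1]$, $\alpha\mapsto[f_\alpha]$, is an embedding (i.e. each $f_\alpha$ is a well-defined continuous map, and $\iota$ is a well-defined injective group homomorphism).
   Context: $S^1=\mathbb{R}/\mathbb{Z}$, written additively, and $\pi:\mathbb{R}\to S^1$ is the quotient map. For a continuous map $f:\mathbb{R}\to X$, a sequence $\{t_i\}$ of reals is an $f$-sequence if $\{f(t_i)\}$ converges in $X$. The group of exponents of $f$ is $\mathcal{E}_f=\{\alpha\in\mathbb{R} : \{\pi(\alpha t_i)\}\text{ converges in }S^1\text{ for all }f\text{-sequences }\{t_i\}\}$, a subgroup of $(\mathbb{R},+)$. The map $f$ is stable if there is an unbounded $f$-sequence. $[M;S^1]$ is the group of homotopy classes of continuous maps $M\to S^1$, with the group structure induced by pointwise addition of maps. *)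

theory Defs
  imports "HOL-Analysis.Analysis" "HOL-Algebra.Group"
begin

section \<open>The circle group \<open>\<real>/\<int>\<close>\<close>

quotient_type circle = real / "\<lambda>x y :: real. x - y \<in> \<int>"
proof (rule equivpI)
  show "reflp (\<lambda>x y :: real. x - y \<in> \<int>)"
    by (simp add: reflp_def)
  show "symp (\<lambda>x y :: real. x - y \<in> \<int>)"
  proof (rule sympI)
    fix x y :: real
    assume "x - y \<in> \<int>"
    then have "- (x - y) \<in> \<int>" by (rule Ints_minus)
    then show "y - x \<in> \<int>" by simp
  qed
  show "transp (\<lambda>x y :: real. x - y \<in> \<int>)"
  proof (rule transpI)
    fix x y z :: real
    assume "x - y \<in> \<int>" "y - z \<in> \<int>"
    then have "(x - y) + (y - z) \<in> \<int>" by (rule Ints_add)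
    then show "x - z \<in> \<int>" by simp
  qed
qed

lift_definition to_circle :: "real \<Rightarrow> circle" is "\<lambda>x. x" .

lemma to_circle_eq_iff: "to_circle x = to_circle y \<longleftrightarrow> x - y \<in> \<int>"
  by transfer simp

lemma to_circle_cases: obtains x where "s = to_circle x"
  by (metis Quotient3_abs_rep Quotient3_circle to_circle.abs_eq)

instantiation circle :: ab_group_add
begin

lift_definition zero_circle :: circle is "0 :: real" .

lift_definition plus_circle :: "circle \<Rightarrow> circle \<Rightarrow> circle" is "(+) :: real \<Rightarrow> real \<Rightarrow> real"
proof -
  fix x x' y y' :: real
  assume "x - x' \<in> \<int>" "y - y' \<in> \<int>"
  then have "(x - x') + (y - y') \<in> \<int>" by (rule Ints_add)
  then show "x + y - (x' + y') \<in> \<int>" by (simp add: algebra_simps)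
qed

lift_definition uminus_circle :: "circle \<Rightarrow> circle" is "uminus :: real \<Rightarrow> real"
proof -
  fix x x' :: real
  assume "x - x' \<in> \<int>"
  then have "- (x - x') \<in> \<int>" by (rule Ints_minus)
  then show "- x - - x' \<in> \<int>" by simp
qed

lift_definition minus_circle :: "circle \<Rightarrow> circle \<Rightarrow> circle" is "(-) :: real \<Rightarrow> real \<Rightarrow> real"
proof -
  fix x x' y y' :: real
  assume "x - x' \<in> \<int>" "y - y' \<in> \<int>"
  then have "(x - x') - (y - y') \<in> \<int>" by (rule Ints_diff)
  then show "x - y - (x' - y') \<in> \<int>" by (simp add: algebra_simps)
qed

instance
  by (standard; transfer; simp)

end

lemma to_circle_0: "to_circle 0 = 0"
  by transfer simp

lemma to_circle_add: "to_circle (x + y) = to_circle x + to_circle y"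
  by transfer simp

lemma to_circle_minus: "to_circle (- x) = - to_circle x"
  by transfer simp

text \<open>The quotient topology.\<close>

instantiation circle :: topological_space
begin

definition open_circle :: "circle set \<Rightarrow> bool"
  where "open_circle U \<longleftrightarrow> open (to_circle -` U)"

instance
proof
  show "open (UNIV :: circle set)"
    by (simp add: open_circle_def)
  show "open (U \<inter> V)" if "open U" "open V" for U V :: "circle set"
    using that by (simp add: open_circle_def open_Int)
  show "open (\<Union>K)" if "\<forall>U\<in>K. open U" for K :: "circle set set"
    using that by (simp add: open_circle_def vimage_Union open_UN)
qed

end

lemma continuous_on_to_circle: "continuous_on S to_circle"
proof -
  have "continuous_on UNIV to_circle"
    by (simp add: continuous_on_open_vimage open_circle_def)
  then show ?thesis
    using continuous_on_subset by blast
qed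

lemma tendsto_to_circle: "(g \<longlongrightarrow> x) F \<Longrightarrow> ((\<lambda>i. to_circle (g i)) \<longlongrightarrow> to_circle x) F"
  using continuous_on_tendsto_compose[OF continuous_on_to_circle[of UNIV]] by simp

lemma open_map_to_circle:
  assumes "open A"
  shows "open (to_circle ` A)"
proof -
  have "to_circle -` (to_circle ` A) = (\<Union>n\<in>\<int>. (+) n ` A)"
    (is "?L = ?R")
  proof (rule Set.set_eqI)
    fix x
    have "x \<in> ?L \<longleftrightarrow> (\<exists>a\<in>A. x - a \<in> \<int>)"
      by (auto simp: image_iff to_circle_eq_iff)
    also have "\<dots> \<longleftrightarrow> x \<in> ?R"
    proof
      assume "\<exists>a\<in>A. x - a \<in> \<int>"
      then obtain a where "a \<in> A" "x - a \<in> \<int>" by blast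
      then show "x \<in> ?R"
        by (intro UN_I[of "x - a"] image_eqI[of _ _ a]) simp_all
    next
      assume "x \<in> ?R"
      then obtain n a where "n \<in> \<int>" "a \<in> A" "x = n + a" by blast
      then show "\<exists>a\<in>A. x - a \<in> \<int>"
        by (intro bexI[of _ a]) simp_all
    qed
    finally show "x \<in> ?L \<longleftrightarrow> x \<in> ?R" .
  qed
  then show ?thesis
    using assms by (simp add: open_circle_def open_UN open_translation)
qed

lemma eventually_nhds_to_circle:
  "eventually P (nhds (to_circle x)) \<longleftrightarrow> eventually (\<lambda>y. P (to_circle y)) (nhds x)"
proof
  assume "eventually P (nhds (to_circle x))"
  then show "eventually (\<lambda>y. P (to_circle y)) (nhds x)"
    using tendsto_to_circle[OF filterlim_ident, of x] by (simp add: filterlim_iff)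
next
  assume "eventually (\<lambda>y. P (to_circle y)) (nhds x)"
  then obtain A where "open A" "x \<in> A" "\<forall>y\<in>A. P (to_circle y)"
    by (auto simp: eventually_nhds)
  then show "eventually P (nhds (to_circle x))"
    unfolding eventually_nhds
    by (intro exI[of _ "to_circle ` A"]) (auto intro: open_map_to_circle)
qed

lemma nhds_to_circle: "nhds (to_circle x) = filtermap to_circle (nhds x)"
  by (rule filter_eqI) (simp add: eventually_nhds_to_circle eventually_filtermap)

instance circle :: topological_ab_group_add
proof
  fix a b :: circle
  obtain x y where xy: "a = to_circle x" "b = to_circle y"
    by (metis to_circle_cases)
  have "((\<lambda>p. to_circle (fst p + snd p)) \<longlongrightarrow> to_circle (x + y)) (nhds x \<times>\<^sub>F nhds y)"
    by (intro tendsto_to_circle tendsto_add_Pair)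
  then show "((\<lambda>p. fst p + snd p) \<longlongrightarrow> a + b) (nhds a \<times>\<^sub>F nhds b)"
    by (simp add: xy nhds_to_circle prod_filtermap1 prod_filtermap2 filterlim_filtermap
        to_circle_add case_prod_unfold)
  have "((\<lambda>z. to_circle (- z)) \<longlongrightarrow> to_circle (- x)) (nhds x)"
    by (intro tendsto_to_circle tendsto_uminus_nhds)
  then show "(uminus \<longlongrightarrow> - a) (nhds a)"
    by (simp add: xy nhds_to_circle filterlim_filtermap to_circle_minus)
qed

instance circle :: t2_space
proof
  fix a b :: circle
  assume "a \<noteq> b"
  obtain x y where xy: "a = to_circle x" "b = to_circle y"
    by (metis to_circle_cases)
  have "open (- \<int> :: real set)"
    by (simp add: open_Compl)
  moreover have "x - y \<in> - \<int>"
    using \<open>a \<noteq> b\<close> by (simp add: xy to_circle_eq_iff)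
  ultimately obtain e where e: "e > 0" "ball (x - y) e \<subseteq> - \<int>"
    using open_contains_ball by blast
  have "to_circle u \<noteq> to_circle v" if "u \<in> ball x (e/2)" "v \<in> ball y (e/2)" for u v
  proof -
    have "u - v \<in> ball (x - y) e"
      using that by (simp add: dist_real_def abs_if split: if_splits)
    then show ?thesis
      using e(2) by (auto simp: to_circle_eq_iff)
  qed
  then have "to_circle ` ball x (e/2) \<inter> to_circle ` ball y (e/2) = {}"
    by blast
  moreover have "open (to_circle ` ball x (e/2))" "open (to_circle ` ball y (e/2))"
    by (simp_all add: open_map_to_circle)
  moreover have "a \<in> to_circle ` ball x (e/2)" "b \<in> to_circle ` ball y (e/2)"
    using e(1) by (auto simp: xy)
  ultimately show "\<exists>U V. open U \<and> open V \<and> a \<in> U \<and> b \<in> V \<and> U \<inter> V = {}"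
    by blast
qed

section \<open>The group of homotopy classes of maps to the circle\<close>

text \<open>A continuous map \<open>M \<rightarrow> S\<^sup>1\<close> is represented by any total function that is continuous on \<open>M\<close>.
  Two such functions that agree on \<open>M\<close> are homotopic in the sense of \<^const>\<open>homotopic_with\<close>, so
  the values outside \<open>M\<close> do not matter for homotopy classes.\<close>

definition circle_homotopic :: "'a::topological_space set \<Rightarrow> (('a \<Rightarrow> circle) \<times> ('a \<Rightarrow> circle)) set"
  where "circle_homotopic M = {(g, h). homotopic_with_canon (\<lambda>_. True) M UNIV g h}"

definition circle_homotopy_class :: "'a::topological_space set \<Rightarrow> ('a \<Rightarrow> circle) \<Rightarrow> ('a \<Rightarrow> circle) set"
  where "circle_homotopy_class M g = circle_homotopic M `` {g}"

definition circle_homotopy_group :: "'a::topological_space set \<Rightarrow> ('a \<Rightarrow> circle) set monoid"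
  where "circle_homotopy_group M =
    \<lparr>carrier = {g. continuous_on M g} // circle_homotopic M,
     monoid.mult = (\<lambda>A B. \<Union>g\<in>A. \<Union>h\<in>B. circle_homotopy_class M (\<lambda>x. g x + h x)),
     one = circle_homotopy_class M (\<lambda>_. 0)\<rparr>"

lemma equiv_circle_homotopic: "equiv {g. continuous_on M g} (circle_homotopic M)"
proof (rule equivI)
  show "circle_homotopic M \<subseteq> {g. continuous_on M g} \<times> {g. continuous_on M g}"
    unfolding circle_homotopic_def using homotopic_with_imp_continuous by blast
  show "refl_on {g. continuous_on M g} (circle_homotopic M)"
    by (auto simp: refl_on_def circle_homotopic_def)
  show "sym (circle_homotopic M)"
    by (auto simp: sym_def circle_homotopic_def intro: homotopic_with_symD)
  show "trans (circle_homotopic M)"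
    by (auto simp: trans_def circle_homotopic_def intro: homotopic_with_trans)
qed

lemma circle_homotopic_add:
  assumes "(g, g') \<in> circle_homotopic M" "(h, h') \<in> circle_homotopic M"
  shows "((\<lambda>x. g x + h x), (\<lambda>x. g' x + h' x)) \<in> circle_homotopic M"
proof -
  obtain k where k: "continuous_on ({0..1::real} \<times> M) k" "\<forall>x. k (0, x) = g x" "\<forall>x. k (1, x) = g' x"
    using assms(1) by (auto simp: circle_homotopic_def homotopic_with_def)
  obtain l where l: "continuous_on ({0..1::real} \<times> M) l" "\<forall>x. l (0, x) = h x" "\<forall>x. l (1, x) = h' x"
    using assms(2) by (auto simp: circle_homotopic_def homotopic_with_def)
  have "continuous_on ({0..1} \<times> M) (\<lambda>p. k p + l p)"
    by (intro continuous_on_add k l)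
  then show ?thesis
    unfolding circle_homotopic_def homotopic_with_def
    using k l by (auto intro!: exI[of _ "\<lambda>p. k p + l p"])
qed

lemma circle_homotopic_minus:
  assumes "(g, g') \<in> circle_homotopic M"
  shows "((\<lambda>x. - g x), (\<lambda>x. - g' x)) \<in> circle_homotopic M"
proof -
  obtain k where k: "continuous_on ({0..1::real} \<times> M) k" "\<forall>x. k (0, x) = g x" "\<forall>x. k (1, x) = g' x"
    using assms(1) by (auto simp: circle_homotopic_def homotopic_with_def)
  have "continuous_on ({0..1} \<times> M) (\<lambda>p. - k p)"
    by (intro continuous_on_minus k)
  then show ?thesis
    unfolding circle_homotopic_def homotopic_with_def
    using k by (auto intro!: exI[of _ "\<lambda>p. - k p"])
qed

lemma circle_homotopy_class_eq_iff:
  assumes "continuous_on M g" "continuous_on M h"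
  shows "circle_homotopy_class M g = circle_homotopy_class M h \<longleftrightarrow>
    homotopic_with_canon (\<lambda>_. True) M UNIV g h"
  using eq_equiv_class_iff[OF equiv_circle_homotopic, of g M h] assms
  by (simp add: circle_homotopy_class_def circle_homotopic_def)

lemma carrier_circle_homotopy_group:
  "carrier (circle_homotopy_group M) = circle_homotopy_class M ` {g. continuous_on M g}"
  by (auto simp: circle_homotopy_group_def quotient_def circle_homotopy_class_def)

lemma mult_circle_homotopy_group:
  assumes "continuous_on M g" "continuous_on M h"
  shows "circle_homotopy_class M g \<otimes>\<^bsub>circle_homotopy_group M\<^esub> circle_homotopy_class M h =
    circle_homotopy_class M (\<lambda>x. g x + h x)"
proof -
  have "congruent2 (circle_homotopic M) (circle_homotopic M)
      (\<lambda>g h. circle_homotopy_class M (\<lambda>x. g x + h x))"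
    unfolding congruent2_def circle_homotopy_class_def
    using equiv_class_eq[OF equiv_circle_homotopic] circle_homotopic_add by blast
  from UN_equiv_class2[OF equiv_circle_homotopic equiv_circle_homotopic this] assms
  show ?thesis
    by (simp add: circle_homotopy_group_def circle_homotopy_class_def)
qed

lemma comm_group_circle_homotopy_group: "comm_group (circle_homotopy_group M)"
proof (rule comm_groupI)
  note simps = carrier_circle_homotopy_group mult_circle_homotopy_group continuous_on_add
  let ?G = "circle_homotopy_group M"
  have one: "\<one>\<^bsub>?G\<^esub> = circle_homotopy_class M (\<lambda>_. 0)"
    by (simp add: circle_homotopy_group_def)
  show "\<one>\<^bsub>?G\<^esub> \<in> carrier ?G"
    by (auto simp: one simps)
  show "a \<otimes>\<^bsub>?G\<^esub> b \<in> carrier ?G" if "a \<in> carrier ?G" "b \<in> carrier ?G" for a b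
    using that by (auto simp: simps)
  show "a \<otimes>\<^bsub>?G\<^esub> b \<otimes>\<^bsub>?G\<^esub> c = a \<otimes>\<^bsub>?G\<^esub> (b \<otimes>\<^bsub>?G\<^esub> c)"
    if "a \<in> carrier ?G" "b \<in> carrier ?G" "c \<in> carrier ?G" for a b c
    using that by (auto simp: simps add.assoc)
  show "a \<otimes>\<^bsub>?G\<^esub> b = b \<otimes>\<^bsub>?G\<^esub> a" if "a \<in> carrier ?G" "b \<in> carrier ?G" for a b
    using that by (auto simp: simps add.commute)
  show "\<one>\<^bsub>?G\<^esub> \<otimes>\<^bsub>?G\<^esub> a = a" if "a \<in> carrier ?G" for a
    using that by (auto simp: one simps)
  show "\<exists>b\<in>carrier ?G. b \<otimes>\<^bsub>?G\<^esub> a = \<one>\<^bsub>?G\<^esub>" if a: "a \<in> carrier ?G" for a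
  proof -
    obtain g where g: "a = circle_homotopy_class M g" "continuous_on M g"
      using a by (auto simp: simps)
    then have "continuous_on M (\<lambda>x. - g x)"
      by (intro continuous_on_minus)
    with g show ?thesis
      by (intro bexI[of _ "circle_homotopy_class M (\<lambda>x. - g x)"]) (simp_all add: one simps)
  qed
qed

section \<open>Exponents of a map\<close>

definition f_sequence :: "(real \<Rightarrow> 'a::metric_space) \<Rightarrow> (nat \<Rightarrow> real) \<Rightarrow> bool"
  where "f_sequence f t \<longleftrightarrow> convergent (\<lambda>i. f (t i))"

definition stable :: "(real \<Rightarrow> 'a::metric_space) \<Rightarrow> bool"
  where "stable f \<longleftrightarrow> (\<exists>t. f_sequence f t \<and> \<not> bounded (range t))"

definition exponents :: "(real \<Rightarrow> 'a::metric_space) \<Rightarrow> real set"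
  where "exponents f = {\<alpha>. \<forall>t. f_sequence f t \<longrightarrow> convergent (\<lambda>i. to_circle (\<alpha> * t i))}"

definition exponent_group :: "(real \<Rightarrow> 'a::metric_space) \<Rightarrow> real monoid"
  where "exponent_group f = \<lparr>carrier = exponents f, monoid.mult = (+), one = 0\<rparr>"

lemma comm_group_exponent_group: "comm_group (exponent_group f)"
proof (rule comm_groupI)
  show "\<one>\<^bsub>exponent_group f\<^esub> \<in> carrier (exponent_group f)"
    by (simp add: exponent_group_def exponents_def convergent_const)
  show "\<alpha> \<otimes>\<^bsub>exponent_group f\<^esub> \<beta> \<in> carrier (exponent_group f)"
    if "\<alpha> \<in> carrier (exponent_group f)" "\<beta> \<in> carrier (exponent_group f)" for \<alpha> \<beta>
    using that
    by (simp add: exponent_group_def exponents_def distrib_right to_circle_add convergent_add)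
  show "\<exists>\<beta>\<in>carrier (exponent_group f). \<beta> \<otimes>\<^bsub>exponent_group f\<^esub> \<alpha> = \<one>\<^bsub>exponent_group f\<^esub>"
    if "\<alpha> \<in> carrier (exponent_group f)" for \<alpha>
  proof (rule bexI[of _ "- \<alpha>"])
    have "convergent (\<lambda>i. - to_circle (\<alpha> * t i))" if "f_sequence f t" for t
      using that \<open>\<alpha> \<in> _\<close> unfolding convergent_def
      by (fastforce simp: exponent_group_def exponents_def convergent_def intro: tendsto_minus)
    then show "- \<alpha> \<in> carrier (exponent_group f)"
      by (simp add: exponent_group_def exponents_def to_circle_minus)
  qed (simp add: exponent_group_def)
qed (simp_all add: exponent_group_def)

text \<open>The induced map \<open>f\<^sub>\<alpha>\<close> is determined by its values on limits of \<open>f\<close>-sequences, that is, on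
  \<open>closure (range f)\<close>.\<close>

definition induced_map :: "(real \<Rightarrow> 'a::metric_space) \<Rightarrow> real \<Rightarrow> 'a \<Rightarrow> circle"
  where "induced_map f \<alpha> x = (THE s. \<forall>t. (\<lambda>i. f (t i)) \<longlonglongrightarrow> x \<longrightarrow> (\<lambda>i. to_circle (\<alpha> * t i)) \<longlonglongrightarrow> s)"

end

theory Submission
  imports Defs
begin

text \<open>Uniqueness of \<open>f\<^sub>\<alpha>\<close> follows by interleaving two \<open>f\<close>-sequences with the same limit, and
  continuity from regularity of the circle. For injectivity, let \<open>h\<close> be a homotopy from \<open>f\<^sub>\<alpha>\<close> to
  \<open>f\<^sub>\<beta>\<close>. Lifting \<open>(s, t) \<mapsto> h (s, f t) - h (0, f t)\<close> to a real function vanishing at \<open>s = 0\<close>,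
  its value at \<open>s = 1\<close> must be \<open>(\<beta> - \<alpha>) t + c\<close> for a constant \<open>c\<close>. Along an unbounded
  \<open>f\<close>-sequence \<open>t\<^sub>n\<close> with \<open>f t\<^sub>n \<rightarrow> x\<close>, the lift over \<open>t\<^sub>n\<close> depends only on the homotopy over the
  compact set \<open>{x} \<union> {f t\<^sub>n}\<close>, and hence is bounded, which forces \<open>\<alpha> = \<beta>\<close>.\<close>

section \<open>The circle group\<close>

lemma to_circle_diff: "to_circle (x - y) = to_circle x - to_circle y"
  by transfer simp

text \<open>The standard identification of the circle \<open>\<real>/\<int>\<close> with the complex
  unit circle. It gives access to continuous logarithms, which concern maps into
  \<open>sphere 0 1\<close>.\<close>

lift_definition circle_cis :: "circle \<Rightarrow> complex" is "\<lambda>x. cis (2 * pi * x)"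
proof -
  fix x y :: real
  assume "x - y \<in> \<int>"
  then obtain n where "x = y + of_int n"
    by (metis Ints_cases add.commute diff_add_cancel)
  then have "cis (2 * pi * x) = cis (2 * pi * y) * cis (2 * pi * of_int n)"
    by (simp add: cis_mult distrib_left del: cis_multiple_2pi)
  then show "cis (2 * pi * x) = cis (2 * pi * y)"
    by simp
qed

lemma circle_cis_to_circle: "circle_cis (to_circle x) = cis (2 * pi * x)"
  by transfer simp

lemma norm_circle_cis: "norm (circle_cis a) = 1"
  by transfer simp

lemma inj_circle_cis: "inj circle_cis"
proof (rule injI)
  fix a b
  assume eq: "circle_cis a = circle_cis b"
  obtain x y where xy: "a = to_circle x" "b = to_circle y"
    by (metis to_circle_cases)
  have "cis (2 * pi * x) / cis (2 * pi * y) = 1"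
    using eq by (simp add: xy circle_cis_to_circle)
  then have "cis (2 * pi * (x - y)) = 1"
    by (simp add: cis_divide right_diff_distrib)
  then have "cos (2 * pi * (x - y)) = 1"
    by (metis cis.simps(1) one_complex.simps(1))
  then obtain n :: int where "2 * pi * (x - y) = of_int n * 2 * pi"
    using cos_one_2pi_int by blast
  then have "x - y = n"
    by simp
  then show "a = b"
    by (simp add: xy to_circle_eq_iff)
qed

text \<open>In the quotient topology, openness is tested on preimages in the line, where the map
  becomes the continuous \<open>cis (2 * pi * x)\<close>.\<close>

lemma continuous_on_circle_cis: "continuous_on S circle_cis"
proof -
  have "open (circle_cis -` B)" if "open B" for B
  proof -
    have "open ((\<lambda>x. cis (2 * pi * x)) -` B)"
      using that by (intro open_vimage continuous_intros)
    then show ?thesis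
      by (simp add: open_circle_def vimage_def circle_cis_to_circle)
  qed
  then have "continuous_on UNIV circle_cis"
    by (simp add: continuous_on_open_vimage)
  then show ?thesis
    using continuous_on_subset by blast
qed

text \<open>The image of a small ball is open because \<open>to_circle\<close> is an open map. Its
  closure stays inside the image of the closed ball, which is compact and hence closed in the
  Hausdorff circle.\<close>

lemma circle_regular:
  fixes U :: "circle set"
  assumes "open U" "a \<in> U"
  obtains V where "open V" "a \<in> V" "closure V \<subseteq> U"
proof -
  obtain x where x: "a = to_circle x"
    by (rule to_circle_cases)
  have "open (to_circle -` U)" "x \<in> to_circle -` U"
    using assms by (simp_all add: x open_circle_def)
  then obtain e where e: "e > 0" "cball x e \<subseteq> to_circle -` U"
    by (meson open_contains_cball)
  have "compact (to_circle ` cball x e)"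
    by (intro compact_continuous_image continuous_on_to_circle compact_cball)
  then have "closure (to_circle ` ball x e) \<subseteq> to_circle ` cball x e"
    by (intro closure_minimal compact_imp_closed) auto
  moreover have "open (to_circle ` ball x e)" "a \<in> to_circle ` ball x e"
    using e(1) by (auto simp: x intro: open_map_to_circle)
  ultimately show ?thesis
    using e(2) by (intro that[of "to_circle ` ball x e"]) auto
qed

section \<open>Lifting homotopies\<close>

text \<open>Shrinking the time interval to 0 deforms \<open>k\<close> to its initial map, which is
  constant, so \<open>k\<close> is inessential and has a continuous logarithm. Nothing is asked of
  the set \<open>U\<close>, so it may be a totally disconnected one such as a convergent
  sequence.\<close>

lemma circle_homotopy_lift:
  fixes k :: "real \<times> 'c::real_normed_vector \<Rightarrow> circle"
  assumes cont: "continuous_on ({0..1} \<times> U) k" and zero: "\<And>y. y \<in> U \<Longrightarrow> k (0, y) = 0"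
  obtains g :: "real \<times> 'c \<Rightarrow> real"
  where "continuous_on ({0..1} \<times> U) g"
    and "\<And>y. y \<in> U \<Longrightarrow> g (0, y) = 0"
    and "\<And>z. z \<in> {0..1} \<times> U \<Longrightarrow> to_circle (g z) = k z"
proof -
  \<comment> \<open>The first coordinate of \<open>p\<close> is the deformation parameter; it
    multiplies the time coordinate of \<open>k\<close>.\<close>
  define H where "H = (\<lambda>p :: real \<times> real \<times> 'c. circle_cis (k (fst p * fst (snd p), snd (snd p))))"
  have "continuous_on ({0..1} \<times> {0..1} \<times> U) H"
    unfolding H_def
    by (rule continuous_on_compose2[OF continuous_on_circle_cis[of UNIV]],
        rule continuous_on_compose2[OF cont])
      (auto intro!: continuous_intros mult_le_one)
  moreover have "H ` ({0..1} \<times> {0..1} \<times> U) \<subseteq> sphere 0 1"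
    by (auto simp: H_def norm_circle_cis)
  moreover have "\<forall>x\<in>{0..1} \<times> U. H (0, x) = 1"
    using zero by (auto simp: H_def circle_cis_to_circle simp flip: to_circle_0)
  moreover have "\<forall>x\<in>{0..1} \<times> U. H (1, x) = circle_cis (k x)"
    by (auto simp: H_def)
  ultimately have "homotopic_with_canon (\<lambda>_. True) ({0..1} \<times> U) (sphere 0 1) (\<lambda>_. 1) (\<lambda>z. circle_cis (k z))"
    by (subst homotopic_with) (auto intro!: exI[of _ H])
  then obtain l where l: "continuous_on ({0..1} \<times> U) l"
      "\<And>z. z \<in> {0..1} \<times> U \<Longrightarrow> circle_cis (k z) = exp (\<i> * of_real (l z))"
    using inessential_eq_continuous_logarithm_circle[of "{0..1} \<times> U" "\<lambda>z. circle_cis (k z)"]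
      homotopic_with_symD by blast
  have lift: "to_circle (l z / (2 * pi)) = k z" if "z \<in> {0..1} \<times> U" for z
    using l(2)[OF that] injD[OF inj_circle_cis]
    by (simp add: circle_cis_to_circle cis_conv_exp)
  show ?thesis
  proof
    \<comment> \<open>Subtracting the value at time 0 normalises the lift. The projection to the
      circle is unchanged, since \<open>l (0, y) / (2 * pi)\<close> lies over
      \<open>k (0, y) = 0\<close>.\<close>
    show "continuous_on ({0..1} \<times> U) (\<lambda>z. (l z - l (0, snd z)) / (2 * pi))"
      by (intro continuous_intros l(1) continuous_on_compose2[OF l(1)]) auto
    show "to_circle ((l z - l (0, snd z)) / (2 * pi)) = k z" if "z \<in> {0..1} \<times> U" for z
    proof -
      have "(0 :: real, snd z) \<in> {0..1} \<times> U" "k (0, snd z) = 0"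
        using that zero by auto
      then show ?thesis
        using lift[OF that] lift[of "(0, snd z)"] by (simp add: diff_divide_distrib to_circle_diff)
    qed
  qed simp
qed

text \<open>The difference of two lifts is continuous with integer values, so distinct values are at
  least 1 apart and connectedness leaves only one.\<close>

lemma to_circle_lifts_differ_by_constant:
  fixes g h :: "'a::topological_space \<Rightarrow> real"
  assumes "connected S" "continuous_on S g" "continuous_on S h"
    and "\<And>x. x \<in> S \<Longrightarrow> to_circle (g x) = to_circle (h x)"
  obtains c where "\<And>x. x \<in> S \<Longrightarrow> g x = h x + c"
proof -
  have "(\<lambda>x. g x - h x) constant_on S"
  proof (rule continuous_discrete_range_constant)
    fix x assume x: "x \<in> S"
    have "1 \<le> norm ((g y - h y) - (g x - h x))"
      if "y \<in> S" "g y - h y \<noteq> g x - h x" for y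
    proof -
      have "(g y - h y) - (g x - h x) \<in> \<int>"
        using assms(4)[OF x] assms(4)[OF that(1)] by (simp add: to_circle_eq_iff Ints_diff)
      then show ?thesis
        using that(2) by (simp add: Ints_nonzero_abs_ge1)
    qed
    then show "\<exists>e>0. \<forall>y. y \<in> S \<and> g y - h y \<noteq> g x - h x \<longrightarrow>
        e \<le> norm ((g y - h y) - (g x - h x))"
      by (intro exI[of _ 1]) auto
  qed (intro assms continuous_on_diff)+
  then obtain c where "\<And>x. x \<in> S \<Longrightarrow> g x - h x = c"
    unfolding constant_on_def by blast
  then show ?thesis
    by (intro that[of c]) (simp add: algebra_simps)
qed

text \<open>\<open>circle_homotopy_lift\<close> needs parameters in a normed space, whereas the
  sequence lives in an arbitrary metric space. Indexing it together with its limit by a compact set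
  of reals bridges the gap, and compactness later bounds the lift.\<close>

lemma convergent_sequence_parametrization:
  fixes u :: "nat \<Rightarrow> 'a::metric_space"
  assumes "u \<longlonglongrightarrow> x"
  obtains N :: "real set" and \<phi> where "compact N" "continuous_on N \<phi>" "\<phi> ` N \<subseteq> insert x (range u)"
    "\<And>n. inverse (real (Suc n)) \<in> N" "\<And>n. \<phi> (inverse (real (Suc n))) = u n"
proof -
  define r where "r = (\<lambda>n. inverse (real (Suc n)))"
  define N where "N = insert 0 (range r)"
  \<comment> \<open>The index is read off from the injective \<open>r\<close>, so \<open>u\<close>
    may repeat values or hit its limit.\<close>
  define \<phi> where "\<phi> = (\<lambda>y. if y = 0 then x else u (the_inv r y))"
  have inj: "inj r"
    by (auto simp: r_def inj_def)
  have pos: "r n > 0" for n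
    by (simp add: r_def)
  have \<phi>r: "\<phi> (r n) = u n" for n
    using pos[of n] by (simp add: \<phi>_def inj the_inv_f_f)
  have lim: "r \<longlonglongrightarrow> 0"
    unfolding r_def by (rule LIMSEQ_inverse_real_of_nat)
  have "compact N"
    unfolding N_def using compact_sequence_with_limit[OF lim] .
  moreover have "continuous_on N \<phi>"
    unfolding N_def continuous_on_iff
  proof (intro ballI allI impI)
    fix y e :: real
    assume y: "y \<in> insert 0 (range r)" and e: "e > 0"
    show "\<exists>d>0. \<forall>y'\<in>insert 0 (range r). dist y' y < d \<longrightarrow> dist (\<phi> y') (\<phi> y) < e"
    proof (cases "y = 0")
      case True
      obtain m where m: "\<And>n. n \<ge> m \<Longrightarrow> dist (u n) x < e"
        using assms e by (meson lim_sequentially)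
      have "dist (\<phi> (r n)) (\<phi> 0) < e" if "dist (r n) 0 < r m" for n
      proof -
        have "n \<ge> m"
          using that by (simp add: r_def)
        then show ?thesis
          unfolding \<phi>r using m by (simp add: \<phi>_def)
      qed
      then show ?thesis
        using e True by (intro exI[of _ "r m"]) (auto simp: pos)
    next
      case False
      then obtain n where n: "y = r n"
        using y by blast
      \<comment> \<open>Nonzero points of \<open>N\<close> are isolated: only finitely many lie
        above \<open>y / 2\<close>, so a small enough ball around \<open>y\<close> meets
        \<open>N\<close> in \<open>y\<close> alone.\<close>
      have "finite {m. r m \<ge> y / 2}"
      proof -
        have "eventually (\<lambda>m. r m < y / 2) sequentially"
          using lim pos[of n] by (intro order_tendstoD(2)) (auto simp: n)
        then obtain m0 where "\<And>m. m \<ge> m0 \<Longrightarrow> r m < y / 2"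
          by (auto simp: eventually_sequentially)
        then have "{m. r m \<ge> y / 2} \<subseteq> {..<m0}"
          by (auto simp: not_less[symmetric])
        then show ?thesis
          using finite_subset by blast
      qed
      then have "finite (r ` {m. r m \<ge> y / 2})"
        by blast
      then obtain d where d: "d > 0" "\<And>z. z \<in> r ` {m. r m \<ge> y / 2} \<Longrightarrow> z \<noteq> y \<Longrightarrow> d \<le> dist y z"
        using finite_set_avoid by metis
      have "y > 0"
        by (simp add: n pos)
      have "y' = y" if "y' \<in> insert 0 (range r)" "dist y' y < min d (y / 2)" for y'
      proof (rule ccontr)
        assume "y' \<noteq> y"
        have "y' > y / 2"
          using that(2) by (simp add: dist_real_def abs_if split: if_splits)
        then have "y' \<in> r ` {m. r m \<ge> y / 2}"
          using that(1) \<open>y > 0\<close> by auto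
        then show False
          using d(2)[of y'] that(2) \<open>y' \<noteq> y\<close> by (simp add: dist_commute)
      qed
      then have "\<forall>y'\<in>insert 0 (range r). dist y' y < min d (y / 2) \<longrightarrow> dist (\<phi> y') (\<phi> y) < e"
        using e by (metis dist_self)
      then show ?thesis
        using d(1) \<open>y > 0\<close> by (intro exI[of _ "min d (y / 2)"] conjI) simp_all
    qed
  qed
  moreover have "\<phi> ` N \<subseteq> insert x (range u)"
    by (auto simp: N_def \<phi>_def)
  ultimately show ?thesis
    using that[of N \<phi>] \<phi>r by (auto simp: N_def r_def)
qed

section \<open>The maps induced by exponents\<close>

lemma tendsto_interleave:
  assumes "u \<longlonglongrightarrow> x" "v \<longlonglongrightarrow> x"
  shows "(\<lambda>n. if even n then u (n div 2) else v (n div 2)) \<longlonglongrightarrow> x"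
proof (rule topological_tendstoI)
  fix S assume "open S" "x \<in> S"
  then have "eventually (\<lambda>n. u n \<in> S \<and> v n \<in> S) sequentially"
    using assms by (auto intro: eventually_conj topological_tendstoD)
  then obtain m where m: "\<And>n. n \<ge> m \<Longrightarrow> u n \<in> S \<and> v n \<in> S"
    by (auto simp: eventually_sequentially)
  then show "eventually (\<lambda>n. (if even n then u (n div 2) else v (n div 2)) \<in> S) sequentially"
    unfolding eventually_sequentially by (intro exI[of _ "2 * m"]) auto
qed

text \<open>The interleaved sequence is itself an \<open>f\<close>-sequence, so its circle images
  converge as a whole. The even and odd subsequences then share that limit, which must be
  \<open>a\<close> since the circle is Hausdorff.\<close>

lemma exponent_limit_unique:
  assumes \<alpha>: "\<alpha> \<in> exponents f"
    and t: "(\<lambda>i. f (t i)) \<longlonglongrightarrow> x" and s: "(\<lambda>i. f (s i)) \<longlonglongrightarrow> x"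
    and lim: "(\<lambda>i. to_circle (\<alpha> * t i)) \<longlonglongrightarrow> a"
  shows "(\<lambda>i. to_circle (\<alpha> * s i)) \<longlonglongrightarrow> a"
proof -
  define u where "u n = (if even n then t (n div 2) else s (n div 2))" for n
  have "(\<lambda>n. f (u n)) = (\<lambda>n. if even n then f (t (n div 2)) else f (s (n div 2)))"
    by (auto simp: u_def)
  then have "f_sequence f u"
    using tendsto_interleave[OF t s] by (auto simp: f_sequence_def convergent_def)
  then obtain b where b: "(\<lambda>n. to_circle (\<alpha> * u n)) \<longlonglongrightarrow> b"
    using \<alpha> by (auto simp: exponents_def convergent_def)
  have "(\<lambda>n. to_circle (\<alpha> * u (2 * n))) \<longlonglongrightarrow> b" "(\<lambda>n. to_circle (\<alpha> * u (Suc (2 * n)))) \<longlonglongrightarrow> b"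
    using LIMSEQ_subseq_LIMSEQ[OF b, of "\<lambda>n. 2 * n"] LIMSEQ_subseq_LIMSEQ[OF b, of "\<lambda>n. Suc (2 * n)"]
    by (simp_all add: strict_mono_def o_def)
  then have "(\<lambda>n. to_circle (\<alpha> * t n)) \<longlonglongrightarrow> b" "(\<lambda>n. to_circle (\<alpha> * s n)) \<longlonglongrightarrow> b"
    by (simp_all add: u_def)
  then show ?thesis
    using LIMSEQ_unique lim by blast
qed

lemma closure_range_sequence:
  fixes f :: "'b \<Rightarrow> 'a::metric_space"
  assumes "x \<in> closure (range f)"
  obtains t where "(\<lambda>i. f (t i)) \<longlonglongrightarrow> x"
proof -
  obtain u where u: "\<forall>n. u n \<in> range f" "u \<longlonglongrightarrow> x"
    using assms unfolding closure_sequential by blast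
  then have "\<forall>n. \<exists>y. u n = f y"
    by blast
  then obtain t where "\<forall>n. u n = f (t n)"
    by metis
  then have "u = (\<lambda>n. f (t n))"
    by blast
  then show ?thesis
    using that[of t] u(2) by simp
qed

text \<open>Justifies the \<open>THE\<close> in \<open>induced_map\<close>. Membership in the
  closure supplies a sequence tending to \<open>x\<close>, without which every \<open>s\<close>
  would qualify.\<close>

lemma ex1_exponent_limit:
  assumes \<alpha>: "\<alpha> \<in> exponents f" and x: "x \<in> closure (range f)"
  shows "\<exists>!s. \<forall>t. (\<lambda>i. f (t i)) \<longlonglongrightarrow> x \<longrightarrow> (\<lambda>i. to_circle (\<alpha> * t i)) \<longlonglongrightarrow> s"
proof -
  obtain t where t: "(\<lambda>i. f (t i)) \<longlonglongrightarrow> x"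
    using closure_range_sequence[OF x] .
  then obtain a where a: "(\<lambda>i. to_circle (\<alpha> * t i)) \<longlonglongrightarrow> a"
    using \<alpha> by (auto simp: exponents_def f_sequence_def convergent_def)
  show ?thesis
  proof (rule ex1I[of _ a])
    show "\<forall>s. (\<lambda>i. f (s i)) \<longlonglongrightarrow> x \<longrightarrow> (\<lambda>i. to_circle (\<alpha> * s i)) \<longlonglongrightarrow> a"
      using exponent_limit_unique[OF \<alpha> t _ a] by blast
  qed (use t a LIMSEQ_unique in blast)
qed

lemma limit_in_closure_range: "(\<lambda>i. f (t i)) \<longlonglongrightarrow> x \<Longrightarrow> x \<in> closure (range f)"
  for f :: "'b \<Rightarrow> 'a::metric_space"
  unfolding closure_sequential by (intro exI[of _ "\<lambda>i. f (t i)"]) simp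

lemma induced_map_tendsto:
  assumes "\<alpha> \<in> exponents f" "(\<lambda>i. f (t i)) \<longlonglongrightarrow> x"
  shows "(\<lambda>i. to_circle (\<alpha> * t i)) \<longlonglongrightarrow> induced_map f \<alpha> x"
  using theI'[OF ex1_exponent_limit[OF assms(1) limit_in_closure_range[of f t x, OF assms(2)]]] assms(2)
  unfolding induced_map_def by blast

lemma induced_map_eqI:
  assumes "\<alpha> \<in> exponents f" "(\<lambda>i. f (t i)) \<longlonglongrightarrow> x" "(\<lambda>i. to_circle (\<alpha> * t i)) \<longlonglongrightarrow> a"
  shows "induced_map f \<alpha> x = a"
  using induced_map_tendsto[OF assms(1,2)] assms(3) LIMSEQ_unique by blast

lemma induced_map_apply:
  assumes "\<alpha> \<in> exponents f"
  shows "induced_map f \<alpha> (f t) = to_circle (\<alpha> * t)"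
  using induced_map_eqI[OF assms, of "\<lambda>_. t"] by simp

lemma continuous_on_induced_map:
  assumes \<alpha>: "\<alpha> \<in> exponents f"
  shows "continuous_on (closure (range f)) (induced_map f \<alpha>)"
  unfolding continuous_on_topological
proof (intro ballI allI impI)
  fix x U
  assume x: "x \<in> closure (range f)" and "open U" "induced_map f \<alpha> x \<in> U"
  then obtain V where V: "open V" "induced_map f \<alpha> x \<in> V" "closure V \<subseteq> U"
    using circle_regular by metis
  \<comment> \<open>Continuity is first checked on the image of \<open>f\<close>: a failure would
    give \<open>f (t n)\<close> tending to \<open>x\<close> while the circle images avoid the
    neighbourhood \<open>V\<close> of their limit.\<close>
  have "\<exists>d>0. \<forall>t. dist (f t) x < d \<longrightarrow> to_circle (\<alpha> * t) \<in> V"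
  proof (rule ccontr)
    assume "\<not> ?thesis"
    then have "\<forall>n. \<exists>t. dist (f t) x < inverse (real (Suc n)) \<and> to_circle (\<alpha> * t) \<notin> V"
      by (metis inverse_positive_iff_positive of_nat_0_less_iff zero_less_Suc)
    then obtain t where t: "\<And>n. dist (f (t n)) x < inverse (real (Suc n))"
        "\<And>n. to_circle (\<alpha> * t n) \<notin> V"
      by metis
    have "(\<lambda>n. dist (f (t n)) x) \<longlonglongrightarrow> 0"
    proof (rule tendsto_sandwich[OF _ _ tendsto_const LIMSEQ_inverse_real_of_nat])
      show "eventually (\<lambda>n. dist (f (t n)) x \<le> inverse (real (Suc n))) sequentially"
        using t(1) less_imp_le by (intro always_eventually allI) blast
    qed simp
    then have "(\<lambda>n. f (t n)) \<longlonglongrightarrow> x"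
      by (subst tendsto_dist_iff)
    then have "eventually (\<lambda>n. to_circle (\<alpha> * t n) \<in> V) sequentially"
      by (rule topological_tendstoD[OF induced_map_tendsto[OF \<alpha>] V(1,2)])
    then show False
      using t(2) by simp
  qed
  then obtain d where d: "d > 0" "\<And>t. dist (f t) x < d \<Longrightarrow> to_circle (\<alpha> * t) \<in> V"
    by blast
  \<comment> \<open>Other points of the closure are reached by limits, which only yields
    \<open>closure V\<close>; this is why \<open>V\<close> was chosen with closure inside
    \<open>U\<close>.\<close>
  have "induced_map f \<alpha> y \<in> U" if y: "y \<in> closure (range f)" "y \<in> ball x d" for y
  proof -
    obtain t where t: "(\<lambda>i. f (t i)) \<longlonglongrightarrow> y"
      using closure_range_sequence[OF y(1)] .
    then have "eventually (\<lambda>i. f (t i) \<in> ball x d) sequentially"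
      using y(2) by (intro topological_tendstoD) auto
    then have "eventually (\<lambda>i. to_circle (\<alpha> * t i) \<in> closure V) sequentially"
      by eventually_elim (simp add: dist_commute d(2) subsetD[OF closure_subset])
    then have "induced_map f \<alpha> y \<in> closure V"
      using Lim_in_closed_set[OF closed_closure _ _ induced_map_tendsto[OF \<alpha> t]] by simp
    then show ?thesis
      using V(3) by blast
  qed
  then show "\<exists>A. open A \<and> x \<in> A \<and> (\<forall>y\<in>closure (range f). y \<in> A \<longrightarrow> induced_map f \<alpha> y \<in> U)"
    using d(1) by (intro exI[of _ "ball x d"]) auto
qed

section \<open>Additivity in the exponent and the induced homomorphism\<close>

lemma exponents_add:
  assumes "\<alpha> \<in> exponents f" "\<beta> \<in> exponents f"
  shows "\<alpha> + \<beta> \<in> exponents f"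
  using assms by (simp add: exponents_def distrib_right to_circle_add convergent_add)

lemma induced_map_add:
  assumes \<alpha>: "\<alpha> \<in> exponents f" and \<beta>: "\<beta> \<in> exponents f" and x: "x \<in> closure (range f)"
  shows "induced_map f (\<alpha> + \<beta>) x = induced_map f \<alpha> x + induced_map f \<beta> x"
proof -
  obtain t where t: "(\<lambda>i. f (t i)) \<longlonglongrightarrow> x"
    using closure_range_sequence[OF x] .
  show ?thesis
    using tendsto_add[OF induced_map_tendsto[OF \<alpha> t] induced_map_tendsto[OF \<beta> t]]
    by (intro induced_map_eqI[OF exponents_add[OF \<alpha> \<beta>] t]) (simp add: distrib_right to_circle_add)
qed

text \<open>Representatives are total functions, while \<open>induced_map_add\<close> holds only on
  the closure of the image. Agreement there suffices for equal classes.\<close>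

lemma circle_homotopy_class_cong:
  assumes "continuous_on M g" "\<And>x. x \<in> M \<Longrightarrow> g x = h x"
  shows "circle_homotopy_class M g = circle_homotopy_class M h"
proof -
  have "continuous_on M h"
    using assms by (rule continuous_on_eq)
  moreover have "homotopic_with_canon (\<lambda>_. True) M UNIV g h"
    by (rule homotopic_with_equal) (use assms in simp_all)
  ultimately show ?thesis
    using assms(1) by (simp only: circle_homotopy_class_eq_iff)
qed

lemma group_hom_induced_map:
  "group_hom (exponent_group f) (circle_homotopy_group (closure (range f)))
    (\<lambda>\<alpha>. circle_homotopy_class (closure (range f)) (induced_map f \<alpha>))"
proof (rule group_hom.intro)
  show "group (exponent_group f)" "group (circle_homotopy_group (closure (range f)))"
    by (rule comm_group.axioms(2), rule comm_group_exponent_group comm_group_circle_homotopy_group)+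
  show "group_hom_axioms (exponent_group f) (circle_homotopy_group (closure (range f)))
      (\<lambda>\<alpha>. circle_homotopy_class (closure (range f)) (induced_map f \<alpha>))"
  proof (rule group_hom_axioms.intro, rule homI)
    fix \<alpha> \<beta>
    assume "\<alpha> \<in> carrier (exponent_group f)" "\<beta> \<in> carrier (exponent_group f)"
    then have *: "\<alpha> \<in> exponents f" "\<beta> \<in> exponents f"
      by (simp_all add: exponent_group_def)
    have "circle_homotopy_class (closure (range f)) (induced_map f (\<alpha> + \<beta>)) =
        circle_homotopy_class (closure (range f)) (\<lambda>x. induced_map f \<alpha> x + induced_map f \<beta> x)"
      by (rule circle_homotopy_class_cong[OF continuous_on_induced_map[OF exponents_add[OF *]]])
        (rule induced_map_add[OF *])
    also have "\<dots> = circle_homotopy_class (closure (range f)) (induced_map f \<alpha>)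
          \<otimes>\<^bsub>circle_homotopy_group (closure (range f))\<^esub>
        circle_homotopy_class (closure (range f)) (induced_map f \<beta>)"
      by (simp only: mult_circle_homotopy_group continuous_on_induced_map *)
    finally show "circle_homotopy_class (closure (range f)) (induced_map f (\<alpha> \<otimes>\<^bsub>exponent_group f\<^esub> \<beta>)) =
        circle_homotopy_class (closure (range f)) (induced_map f \<alpha>)
          \<otimes>\<^bsub>circle_homotopy_group (closure (range f))\<^esub>
        circle_homotopy_class (closure (range f)) (induced_map f \<beta>)"
      by (simp add: exponent_group_def)
  qed (simp add: exponent_group_def carrier_circle_homotopy_group continuous_on_induced_map)
qed

section \<open>Injectivity on homotopy classes\<close>

lemma homotopic_induced_maps_eq:
  fixes f :: "real \<Rightarrow> 'a::metric_space"
  assumes f: "continuous_on UNIV f" "stable f"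
    and \<alpha>: "\<alpha> \<in> exponents f" and \<beta>: "\<beta> \<in> exponents f"
    and hom: "homotopic_with_canon (\<lambda>_. True) (closure (range f)) UNIV (induced_map f \<alpha>) (induced_map f \<beta>)"
  shows "\<alpha> = \<beta>"
proof -
  let ?M = "closure (range f)"
  obtain h where h: "continuous_on ({0..1::real} \<times> ?M) h"
      "\<And>x. h (0, x) = induced_map f \<alpha> x" "\<And>x. h (1, x) = induced_map f \<beta> x"
    using hom by (auto simp: homotopic_with_def)
  obtain t x where t: "(\<lambda>i. f (t i)) \<longlonglongrightarrow> x" and unbdd: "\<not> bounded (range t)"
    using f(2) by (auto simp: stable_def f_sequence_def convergent_def)
  have fM: "f y \<in> ?M" for y
    by (rule subsetD[OF closure_subset]) simp
  \<comment> \<open>The homotopy is made to start at the zero map, as lifting requires; it ends at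
    the difference of the two induced maps.\<close>
  define k where "k z = h z - h (0, snd z)" for z
  have k: "continuous_on ({0..1} \<times> ?M) k"
    unfolding k_def by (intro continuous_intros h(1) continuous_on_compose2[OF h(1)]) auto
  have k0: "k (0, y) = 0" for y
    by (simp add: k_def)
  \<comment> \<open>First lift \<open>g1\<close>: over the whole line, via \<open>f\<close>. The
    second lift \<open>g2\<close> will be over the compact \<open>N\<close>, via
    \<open>\<phi>\<close>.\<close>
  have "continuous_on ({0..1} \<times> UNIV) (\<lambda>z. k (fst z, f (snd z)))"
    by (rule continuous_on_compose2[OF k])
      (auto intro!: continuous_intros continuous_on_compose2[OF f(1)] simp: fM)
  then obtain g1 where g1: "continuous_on ({0..1} \<times> UNIV) g1" "\<And>y. g1 (0, y) = 0"
      "\<And>z. z \<in> {0..1} \<times> UNIV \<Longrightarrow> to_circle (g1 z) = k (fst z, f (snd z))"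
    by (rule circle_homotopy_lift) (auto simp: k0)
  obtain N \<phi> where N: "compact N" "continuous_on N \<phi>" "\<phi> ` N \<subseteq> insert x (range (\<lambda>i. f (t i)))"
      "\<And>n. inverse (real (Suc n)) \<in> N" "\<And>n. \<phi> (inverse (real (Suc n))) = f (t n)"
    using convergent_sequence_parametrization[OF t] by metis
  have "\<phi> ` N \<subseteq> ?M"
  proof -
    have "insert x (range (\<lambda>i. f (t i))) \<subseteq> ?M"
      using fM limit_in_closure_range[of f t x, OF t] by (simp add: image_subset_iff)
    with N(3) show ?thesis
      by (rule subset_trans)
  qed
  then have "continuous_on ({0..1} \<times> N) (\<lambda>z. k (fst z, \<phi> (snd z)))"
    by (intro continuous_on_compose2[OF k])
      (auto intro!: continuous_intros continuous_on_compose2[OF N(2)])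
  then obtain g2 where g2: "continuous_on ({0..1} \<times> N) g2" "\<And>y. y \<in> N \<Longrightarrow> g2 (0, y) = 0"
      "\<And>z. z \<in> {0..1} \<times> N \<Longrightarrow> to_circle (g2 z) = k (fst z, \<phi> (snd z))"
    by (rule circle_homotopy_lift) (auto simp: k0)
  have "bounded (g2 ` ({0..1} \<times> N))"
    by (intro compact_imp_bounded compact_continuous_image g2(1) compact_Times N(1)) simp
  then obtain B where B: "\<And>z. z \<in> {0..1} \<times> N \<Longrightarrow> \<bar>g2 z\<bar> \<le> B"
    unfolding bounded_iff real_norm_def by blast
  have "continuous_on UNIV (\<lambda>y. g1 (1, y))"
    by (rule continuous_on_compose2[OF g1(1)]) (auto intro!: continuous_intros)
  \<comment> \<open>At time 1 both \<open>g1\<close> and the linear function lift the same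
    circle-valued map on the connected line, so they differ by a constant.\<close>
  moreover have "to_circle (g1 (1, y)) = to_circle ((\<beta> - \<alpha>) * y)" for y
    using g1(3)[of "(1, y)"] \<alpha> \<beta>
    by (simp add: k_def h induced_map_apply left_diff_distrib to_circle_diff)
  ultimately obtain c where c: "\<And>y. g1 (1, y) = (\<beta> - \<alpha>) * y + c"
    using to_circle_lifts_differ_by_constant[of UNIV "\<lambda>y. g1 (1, y)" "\<lambda>y. (\<beta> - \<alpha>) * y"]
    by (auto intro: continuous_intros)
  \<comment> \<open>Both sides are endpoints of lifts of the single path
    \<open>s \<mapsto> k (s, f (t n))\<close>. The lifts differ by a constant and both vanish at
    \<open>s = 0\<close>, so they coincide.\<close>
  have g12: "g1 (1, t n) = g2 (1, inverse (real (Suc n)))" for n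
  proof -
    let ?r = "inverse (real (Suc n))"
    have "continuous_on {0..1} (\<lambda>s. g1 (s, t n))"
      by (rule continuous_on_compose2[OF g1(1)]) (auto intro!: continuous_intros)
    moreover have "continuous_on {0..1} (\<lambda>s. g2 (s, ?r))"
      by (rule continuous_on_compose2[OF g2(1)]) (use N(4)[of n] in \<open>auto intro!: continuous_intros\<close>)
    moreover have "to_circle (g1 (s, t n)) = to_circle (g2 (s, ?r))" if "s \<in> {0..1}" for s
      using g1(3)[of "(s, t n)"] g2(3)[of "(s, ?r)"] that N(4)[of n] N(5)[of n] by simp
    ultimately obtain c' where "\<And>s. s \<in> {0..1} \<Longrightarrow> g1 (s, t n) = g2 (s, ?r) + c'"
      using to_circle_lifts_differ_by_constant[of "{0..1}" "\<lambda>s. g1 (s, t n)" "\<lambda>s. g2 (s, ?r)"]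
      by auto
    from this[of 0] this[of 1] show ?thesis
      using g1(2)[of "t n"] g2(2)[OF N(4)[of n]] by simp
  qed
  show ?thesis
  proof (rule ccontr)
    assume ne: "\<alpha> \<noteq> \<beta>"
    \<comment> \<open>The bound \<open>B\<close> on \<open>g2\<close> carries over to the affine
      function \<open>(\<beta> - \<alpha>) * t n + c\<close>, whose slope is nonzero.\<close>
    have "\<bar>t n\<bar> \<le> (B + \<bar>c\<bar>) / \<bar>\<beta> - \<alpha>\<bar>" for n
    proof -
      have "\<bar>(\<beta> - \<alpha>) * t n + c\<bar> \<le> B"
        using B[of "(1, inverse (real (Suc n)))"] N(4)[of n] g12[of n] c[of "t n"] by simp
      then have "\<bar>t n\<bar> * \<bar>\<beta> - \<alpha>\<bar> \<le> B + \<bar>c\<bar>"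
        by (simp flip: abs_mult add: mult.commute)
      then show ?thesis
        using ne by (simp add: pos_le_divide_eq)
    qed
    then have "bounded (range t)"
      unfolding bounded_iff by auto
    then show False
      using unbdd by blast
  qed
qed

theorem theorem3:
  fixes f :: "real \<Rightarrow> 'a::metric_space" and M :: "'a set"
  assumes "continuous_on UNIV f" and "stable f" and "M = closure (range f)"
  shows "(\<forall>\<alpha>\<in>exponents f.
            (\<forall>x\<in>M. \<exists>!s. \<forall>t. (\<lambda>i. f (t i)) \<longlonglongrightarrow> x \<longrightarrow> (\<lambda>i. to_circle (\<alpha> * t i)) \<longlonglongrightarrow> s) \<and>
            (\<forall>t x. (\<lambda>i. f (t i)) \<longlonglongrightarrow> x \<longrightarrow>
               x \<in> M \<and> (\<lambda>i. to_circle (\<alpha> * t i)) \<longlonglongrightarrow> induced_map f \<alpha> x) \<and>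
            continuous_on M (induced_map f \<alpha>)) \<and>
         group_hom (exponent_group f) (circle_homotopy_group M)
           (\<lambda>\<alpha>. circle_homotopy_class M (induced_map f \<alpha>)) \<and>
         inj_on (\<lambda>\<alpha>. circle_homotopy_class M (induced_map f \<alpha>)) (exponents f)"
  unfolding assms(3)
proof (intro conjI ballI allI impI)
  show "inj_on (\<lambda>\<alpha>. circle_homotopy_class (closure (range f)) (induced_map f \<alpha>)) (exponents f)"
    \<comment> \<open>Equal classes of continuous maps mean homotopic maps, and homotopic induced
      maps have equal exponents.\<close>
    by (rule inj_onI)
      (simp add: circle_homotopy_class_eq_iff continuous_on_induced_map
        homotopic_induced_maps_eq[OF assms(1,2)])
qed (simp_all add: ex1_exponent_limit limit_in_closure_range induced_map_tendsto
    continuous_on_induced_map group_hom_induced_map)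

end
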